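(* Let $F$ be a finite field, let $n>1$ be an integer, and let $1\le k\le n$. Then the sum of all matrices in $M_n(F)$ of rank $k$ is the zero matrix: $$\sum_{A\in V_k}A=0_n.$$
   Context: $M_n(F)$ is the ring of $n\times n$ matrices over $F$, $V_k$ is the set of all matrices in $M_n(F)$ of rank $k$, and $0_n$ is the $n\times n$ zero matrix. *)

theory Defs
  imports "HOL-Analysis.Cartesian_Space"
begin

definition matrices_of_rank :: "nat \<Rightarrow> ('a::field ^ 'n ^ 'n) set" where
  "matrices_of_rank k = {A. rank A = k}"

end

(* Applying a fixed injective linear map to every row preserves the rank, so it permutes the
   matrices of rank k and fixes their sum. For the transvection adding the j-th coordinate to the
   i-th one, this forces the j-th column of the sum to vanish. *)
theory Submission imports Defs begin

text \<open>Rank is the dimension of the span of the rows, and an injective linear map preserves the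
  dimension of the span of any set.\<close>

lemma rank_map_rows:
  fixes A :: "'a::field ^ 'n ^ 'm" and f :: "'a ^ 'n \<Rightarrow> 'a ^ 'l"
  assumes "Vector_Spaces.linear (*s) (*s) f" and "inj f"
  shows "rank (\<chi> r. f (A $ r)) = rank A"
proof -
  have "rows (\<chi> r. f (A $ r)) = f ` rows A"
    by (auto simp: rows_def row_def)
  then show ?thesis
    unfolding row_rank_def_gen
    using vec.dim_image_eq[OF assms(1) inj_on_subset[OF assms(2) subset_UNIV]] by simp
qed

lemma map_rows_sum_matrices_of_rank:
  fixes f :: "'a::{field,finite} ^ 'n \<Rightarrow> 'a ^ 'n" and k :: nat
  assumes lin: "Vector_Spaces.linear (*s) (*s) f" and inj: "inj f"
  defines "S \<equiv> \<Sum>A \<in> (matrices_of_rank k :: ('a ^ 'n ^ 'n) set). A"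
  shows "f (S $ r) = S $ r"
proof -
  interpret f: Vector_Spaces.linear "(*s)" "(*s)" f by (rule lin)
  let ?V = "matrices_of_rank k :: ('a ^ 'n ^ 'n) set"
  let ?T = "\<lambda>A :: 'a ^ 'n ^ 'n. \<chi> r. f (A $ r)"
  have inj_T: "inj_on ?T ?V"
    by (rule inj_onI, subst vec_eq_iff) (metis inj injD vec_lambda_beta)
  moreover have "?T ` ?V \<subseteq> ?V"
    by (auto simp: matrices_of_rank_def rank_map_rows[OF lin inj])
  \<comment> \<open>As the field is finite, so is \<open>?V\<close>, and an injective self-map of a
    finite set is onto.\<close>
  ultimately have "?T ` ?V = ?V"
    by (intro endo_inj_surj) simp_all
  then have "S = (\<Sum>A\<in>?V. ?T A)"
    using sum.reindex[OF inj_T, of "\<lambda>A. A"] by (simp add: S_def)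
  then have "S $ r = (\<Sum>A\<in>?V. f (A $ r))"
    by (simp add: sum_component)
  also have "\<dots> = f (S $ r)"
    by (simp add: S_def sum_component f.sum)
  finally show ?thesis by simp
qed

theorem theorem3p19:
  fixes k :: nat
  assumes "CARD('n::finite) > 1"
    and "1 \<le> k" and "k \<le> CARD('n)"
  shows "(\<Sum>A \<in> (matrices_of_rank k :: ('a::{field,finite} ^ 'n ^ 'n) set). A) = 0"
proof -
  let ?S = "\<Sum>A \<in> (matrices_of_rank k :: ('a ^ 'n ^ 'n) set). A"
  have "?S $ r $ j = 0" for r j
  proof -
    \<comment> \<open>Here \<open>n > 1\<close> enters: a transvection needs a second
      coordinate.\<close>
    have "(UNIV :: 'n set) \<noteq> {j}"
      using assms(1) by (metis card_1_singleton_iff less_irrefl One_nat_def)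
    then obtain i where "i \<noteq> j"
      by blast
    \<comment> \<open>Scaling by a scalar other than 0 and 1 is impossible over the two-element
      field; a transvection exists over every field.\<close>
    define f where "f = (\<lambda>v :: 'a ^ 'n. \<chi> c. if c = i then v $ i + v $ j else v $ c)"
    have "Vector_Spaces.linear (*s) (*s) f"
      by unfold_locales (simp_all add: f_def vec_eq_iff algebra_simps)
    moreover have "inj f"
    proof (rule injI)
      fix v w assume "f v = f w"
      then have *: "f v $ c = f w $ c" for c
        by simp
      have **: "v $ c = w $ c" if "c \<noteq> i" for c
        using *[of c] that by (simp add: f_def)
      \<comment> \<open>Coordinate \<open>j\<close> is left unchanged by \<open>f\<close>, so it
        already agrees and cancels.\<close>
      moreover have "v $ i = w $ i"
        using *[of i] **[of j] \<open>i \<noteq> j\<close> by (simp add: f_def)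
      ultimately show "v = w"
        by (metis vec_eq_iff)
    qed
    ultimately have "f (?S $ r) $ i = ?S $ r $ i"
      by (simp only: map_rows_sum_matrices_of_rank)
    \<comment> \<open>The \<open>i\<close>-th coordinate now reads
      \<open>?S $ r $ i + ?S $ r $ j = ?S $ r $ i\<close>.\<close>
    then show ?thesis
      by (simp add: f_def)
  qed
  then show ?thesis
    by (simp add: vec_eq_iff)
qed

end
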